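(* Let $\{X_n\}_{n\ge 0}$ be a finite irreducible discrete time Markov chain with state space $\mathcal S=\{1,\dots,m\}$ and stationary probability vector $\boldsymbol\pi=(\pi_1,\dots,\pi_m)^T$. Let $\mathbf f(s)=(f_1(s),\dots,f_m(s))^T$ and $\mathbf g(s)=(g_1(s),\dots,g_m(s))^T$ be the column vectors of probability generating functions of the mixing times, where $f_i(s)=\sum_{n=0}^\infty P\{T_i^{(0)}=n\mid X_0=i\}s^n$ and $g_i(s)=\sum_{n=0}^\infty P\{T_i^{(1)}=n\mid X_0=i\}s^n$. Then for $|s|<1$, $$\mathbf f(s)=[\mathbf F(s)+I-\mathbf F_d(s)]\boldsymbol\pi,\qquad \mathbf g(s)=\mathbf F(s)\boldsymbol\pi.$$
   Context: The mixing variable $M$ is a random variable, independent of the chain, with $P[M=j]=\pi_j$ for all $j\in\mathcal S$. Given $X_0=i$, $T_i^{(0)}=\min\{n\ge 0: X_n=M\}$ and $T_i^{(1)}=\min\{n\ge 1: X_n=M\}$. For $n\ge1$, $f_{ij}^{(n)}=P\{X_n=j,\ X_k\ne j \text{ for } k=1,\dots,n-1\mid X_0=i\}$, with $f_{ij}^{(0)}=0$; $F_{ij}(s)=\sum_{n=0}^\infty f_{ij}^{(n)}s^n$; $\mathbf F(s)=[F_{ij}(s)]$ is the $m\times m$ matrix generating function; $\mathbf F_d(s)$ is the diagonal matrix with the same diagonal entries as $\mathbf F(s)$; $I$ is the identity matrix. *)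

theory Defs
  imports "HOL-Probability.Probability"
begin

definition stochastic_matrix :: "real^'s^'s \<Rightarrow> bool" where
  "stochastic_matrix p \<longleftrightarrow> (\<forall>i j. 0 \<le> p $ i $ j) \<and> (\<forall>i. (\<Sum>j\<in>UNIV. p $ i $ j) = 1)"

(* n-step transition probabilities; the library's "^" on vectors would be componentwise *)
definition matrix_power :: "real^'s^'s \<Rightarrow> nat \<Rightarrow> real^'s^'s" where
  "matrix_power p n = (((**) p) ^^ n) (mat 1)"

definition irreducible_matrix :: "real^'s^'s \<Rightarrow> bool" where
  "irreducible_matrix p \<longleftrightarrow> (\<forall>i j. \<exists>n. 0 < matrix_power p n $ i $ j)"

definition stationary_vector :: "real^'s^'s \<Rightarrow> real^'s \<Rightarrow> bool" where
  "stationary_vector p \<pi> \<longleftrightarrow>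
     (\<forall>j. 0 \<le> \<pi> $ j) \<and> (\<Sum>j\<in>UNIV. \<pi> $ j) = 1 \<and> \<pi> v* p = \<pi>"

(* The initial distribution is left arbitrary. *)
definition markov_chain :: "'w measure \<Rightarrow> (nat \<Rightarrow> 'w \<Rightarrow> 's::finite) \<Rightarrow> real^'s^'s \<Rightarrow> bool" where
  "markov_chain P X p \<longleftrightarrow>
     prob_space P \<and> stochastic_matrix p \<and>
     (\<forall>n. X n \<in> measurable P (count_space UNIV)) \<and>
     (\<forall>n x. \<P>(\<omega> in P. \<forall>k\<le>n. X k \<omega> = x k) > 0 \<longrightarrow>
        \<P>(\<omega> in P. X (Suc n) \<omega> = x (Suc n) \<bar> \<forall>k\<le>n. X k \<omega> = x k) = p $ x n $ x (Suc n))"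

(* Independence of the sigma-algebras generated by the whole process and by M;
   the library's indep_var only covers random variables of equal type. *)
definition mixing_variable ::
  "'w measure \<Rightarrow> (nat \<Rightarrow> 'w \<Rightarrow> 's::finite) \<Rightarrow> real^'s \<Rightarrow> ('w \<Rightarrow> 's) \<Rightarrow> bool" where
  "mixing_variable P X \<pi> M \<longleftrightarrow>
     prob_space.indep_set P
       (sets (vimage_algebra (space P) (\<lambda>\<omega> n. X n \<omega>) (\<Pi>\<^sub>M n\<in>UNIV. count_space UNIV)))
       (sets (vimage_algebra (space P) M (count_space UNIV))) \<and>
     (\<forall>j. \<P>(\<omega> in P. M \<omega> = j) = \<pi> $ j)"

(* min {n. r \<le> n and X_n = M}; the infimum of the empty set is \<infinity> *)
definition mixing_time :: "nat \<Rightarrow> (nat \<Rightarrow> 'w \<Rightarrow> 's) \<Rightarrow> ('w \<Rightarrow> 's) \<Rightarrow> 'w \<Rightarrow> enat" where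
  "mixing_time r X M \<omega> = Inf {enat n |n. r \<le> n \<and> X n \<omega> = M \<omega>}"

definition mixing_prob ::
  "'w measure \<Rightarrow> (nat \<Rightarrow> 'w \<Rightarrow> 's) \<Rightarrow> ('w \<Rightarrow> 's) \<Rightarrow> nat \<Rightarrow> 's \<Rightarrow> nat \<Rightarrow> real" where
  "mixing_prob P X M r i n = \<P>(\<omega> in P. mixing_time r X M \<omega> = enat n \<bar> X 0 \<omega> = i)"

definition first_passage_prob ::
  "'w measure \<Rightarrow> (nat \<Rightarrow> 'w \<Rightarrow> 's) \<Rightarrow> 's \<Rightarrow> 's \<Rightarrow> nat \<Rightarrow> real" where
  "first_passage_prob P X i j n =
     (if n = 0 then 0
      else \<P>(\<omega> in P. X n \<omega> = j \<and> (\<forall>k\<in>{1..n - 1}. X k \<omega> \<noteq> j) \<bar> X 0 \<omega> = i))"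

definition gen_fun :: "(nat \<Rightarrow> real) \<Rightarrow> 'a \<Rightarrow> 'a::{real_normed_field,banach}" where
  "gen_fun a s = (\<Sum>n. of_real (a n) * s ^ n)"

(* In the following, row i is computed under its own measure P i, because a conditional
   probability given X_0 = i is meaningful only if X_0 = i has positive probability. *)

definition mixing_gf ::
  "('s \<Rightarrow> 'w measure) \<Rightarrow> (nat \<Rightarrow> 'w \<Rightarrow> 's::finite) \<Rightarrow> ('w \<Rightarrow> 's) \<Rightarrow> nat \<Rightarrow> 'a \<Rightarrow>
     'a::{real_normed_field,banach}^'s" where
  "mixing_gf P X M r s = (\<chi> i. gen_fun (mixing_prob (P i) X M r i) s)"

definition first_passage_gf ::
  "('s \<Rightarrow> 'w measure) \<Rightarrow> (nat \<Rightarrow> 'w \<Rightarrow> 's::finite) \<Rightarrow> 'a \<Rightarrow>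
     'a::{real_normed_field,banach}^'s^'s" where
  "first_passage_gf P X s = (\<chi> i j. gen_fun (first_passage_prob (P i) X i j) s)"

definition diag_part :: "'a::zero^'s^'s \<Rightarrow> 'a^'s^'s" where
  "diag_part A = (\<chi> i j. if i = j then A $ i $ j else 0)"

definition of_real_vec :: "real^'s \<Rightarrow> 'a::real_algebra_1^'s" where
  "of_real_vec v = (\<chi> j. of_real (v $ j))"

end

theory Submission
  imports Defs
begin

text \<open>
  Split the event that the mixing time equals \<open>n\<close> according to the value \<open>j\<close> of \<open>M\<close>. By independence,
  each piece contributes \<open>\<pi>\<^sub>j\<close> times the law of the hitting time of \<open>j\<close>. Hitting times counted from
  time 1 are first passage times; counting from time 0 changes only the case \<open>j = i\<close>, where the
  hitting time is 0.
\<close>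

lemma summable_gen_fun:
  fixes s :: "'a::{real_normed_field,banach}"
  assumes "\<And>n. \<bar>a n\<bar> \<le> C" and "norm s < 1"
  shows "summable (\<lambda>n. of_real (a n) * s ^ n)"
proof (rule summable_comparison_test')
  show "summable (\<lambda>n. C * norm s ^ n)"
    using assms(2) by (intro summable_mult summable_geometric) simp
  show "norm (of_real (a n) * s ^ n) \<le> C * norm s ^ n" for n
    using assms(1)[of n] by (simp add: norm_mult norm_power mult_right_mono)
qed

text \<open>Bounded coefficients make every series converge absolutely inside the unit disc, by
  comparison with a geometric series, so the finite sum may be moved outside.\<close>

lemma gen_fun_sum:
  fixes s :: "'a::{real_normed_field,banach}"
  assumes "\<And>j n. j \<in> A \<Longrightarrow> \<bar>a j n\<bar> \<le> C" and "norm s < 1"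
  shows "gen_fun (\<lambda>n. \<Sum>j\<in>A. c j * a j n) s = (\<Sum>j\<in>A. of_real (c j) * gen_fun (a j) s)"
proof -
  have summable: "summable (\<lambda>n. of_real (a j n) * s ^ n)" if "j \<in> A" for j
    using summable_gen_fun assms that by blast
  have "gen_fun (\<lambda>n. \<Sum>j\<in>A. c j * a j n) s
      = (\<Sum>n. \<Sum>j\<in>A. of_real (c j) * (of_real (a j n) * s ^ n))"
    by (simp add: gen_fun_def sum_distrib_right mult.assoc)
  also have "\<dots> = (\<Sum>j\<in>A. \<Sum>n. of_real (c j) * (of_real (a j n) * s ^ n))"
    by (intro suminf_sum summable_mult summable)
  also have "\<dots> = (\<Sum>j\<in>A. of_real (c j) * gen_fun (a j) s)"
    unfolding gen_fun_def by (intro sum.cong refl suminf_mult summable)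
  finally show ?thesis .
qed

lemma gen_fun_unit: "gen_fun (\<lambda>n. if n = 0 then 1 else 0) s = 1"
proof -
  have "gen_fun (\<lambda>n. if n = 0 then 1 else 0) s
      = (\<Sum>n. if n = 0 then 1 else 0 :: 'a::{real_normed_field,banach})"
    unfolding gen_fun_def by (rule suminf_cong) simp
  then show ?thesis
    using suminf_finite[of "{0::nat}" "\<lambda>n. if n = 0 then 1 else 0 :: 'a"] by simp
qed

text \<open>Supplies the uniform coefficient bound for \<open>gen_fun_sum\<close>. A null condition
  does no harm, since the quotient is then 0.\<close>

lemma (in prob_space) abs_cond_prob_le_1:
  assumes [measurable]: "Measurable.pred M A" "Measurable.pred M B"
  shows "\<bar>\<P>(\<omega> in M. A \<omega> \<bar> B \<omega>)\<bar> \<le> 1"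
proof -
  have "\<P>(\<omega> in M. A \<omega> \<and> B \<omega>) \<le> \<P>(\<omega> in M. B \<omega>)"
    by (intro finite_measure_mono) auto
  then show ?thesis
    by (simp add: cond_prob_def divide_le_eq_1 zero_less_measure_iff)
qed

lemma Inf_enat_eq_enat_iff:
  "Inf {enat n |n. Q n} = enat n \<longleftrightarrow> Q n \<and> (\<forall>k<n. \<not> Q k)"
proof
  assume eq: "Inf {enat n |n. Q n} = enat n"
  \<comment> \<open>A finite infimum excludes the empty set, whose infimum is \<infinity>; by
    well-ordering, the infimum of a nonempty set is attained.\<close>
  then have "{enat n |n. Q n} \<noteq> {}"
    by (auto simp: Inf_enat_def split: if_splits)
  then have "Inf {enat n |n. Q n} \<in> {enat n |n. Q n}"
    by (meson ex_in_conv wellorder_InfI)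
  then have "Q n"
    using eq by auto
  moreover have "\<not> Q k" if "k < n" for k
    using Inf_lower[of "enat k" "{enat n |n. Q n}"] eq that by auto
  ultimately show "Q n \<and> (\<forall>k<n. \<not> Q k)" by blast
next
  assume "Q n \<and> (\<forall>k<n. \<not> Q k)"
  then show "Inf {enat n |n. Q n} = enat n"
    by (intro antisym Inf_lower Inf_greatest) (auto simp: not_less[symmetric])
qed

text \<open>A condition on a single path with a fixed target \<open>j\<close>. The random target
  \<open>M\<close> can be inserted pathwise, and both starting times are treated at once.\<close>

definition hits_at :: "nat \<Rightarrow> (nat \<Rightarrow> 's) \<Rightarrow> 's \<Rightarrow> nat \<Rightarrow> bool" where
  "hits_at r x j n \<longleftrightarrow> r \<le> n \<and> x n = j \<and> (\<forall>k\<in>{r..<n}. x k \<noteq> j)"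

lemma mixing_time_eq_enat_iff:
  "mixing_time r X M \<omega> = enat n \<longleftrightarrow> hits_at r (\<lambda>n. X n \<omega>) (M \<omega>) n"
  unfolding mixing_time_def Inf_enat_eq_enat_iff hits_at_def by auto

lemma measurable_hits_at [measurable]:
  fixes X :: "nat \<Rightarrow> 'w \<Rightarrow> 's::countable"
  assumes [measurable]: "\<And>n. X n \<in> measurable N (count_space UNIV)"
  shows "Measurable.pred N (\<lambda>\<omega>. hits_at r (\<lambda>n. X n \<omega>) j n)"
  unfolding hits_at_def by measurable

lemma mixing_prob_eq_sum:
  fixes X :: "nat \<Rightarrow> 'w \<Rightarrow> 's::finite"
  assumes chain: "markov_chain P X p" and mix: "mixing_variable P X \<pi> M"
  shows "mixing_prob P X M r i n
      = (\<Sum>j\<in>UNIV. \<pi> $ j * \<P>(\<omega> in P. hits_at r (\<lambda>n. X n \<omega>) j n \<bar> X 0 \<omega> = i))"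
proof -
  interpret prob_space P
    using chain by (simp add: markov_chain_def)
  have X [measurable]: "X n \<in> measurable P (count_space UNIV)" for n
    using chain by (simp add: markov_chain_def)
  let ?G = "vimage_algebra (space P) (\<lambda>\<omega> n. X n \<omega>) (\<Pi>\<^sub>M n\<in>UNIV. count_space UNIV)"
  let ?H = "vimage_algebra (space P) M (count_space UNIV)"
  have indep: "indep_set (sets ?G) (sets ?H)" and law: "\<P>(\<omega> in P. M \<omega> = j) = \<pi> $ j" for j
    using mix by (auto simp: mixing_variable_def)
  \<comment> \<open>The condition on \<open>X 0\<close> belongs to the chain event, so independence
    is applied to unconditional probabilities and the division comes last.\<close>
  let ?A = "\<lambda>j. {\<omega> \<in> space P. hits_at r (\<lambda>n. X n \<omega>) j n \<and> X 0 \<omega> = i}"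
  let ?B = "\<lambda>j. {\<omega> \<in> space P. M \<omega> = j}"
  \<comment> \<open>Independence concerns the sigma-algebra \<open>?G\<close> generated by the path,
    so measurability in \<open>P\<close> is too weak for the events \<open>?A j\<close>.\<close>
  have XG [measurable]: "X k \<in> measurable ?G (count_space UNIV)" for k
  proof -
    have "(\<lambda>\<omega> n. X n \<omega>) \<in> measurable ?G (\<Pi>\<^sub>M n\<in>UNIV. count_space UNIV)"
      by (intro measurable_vimage_algebra1) (auto simp: space_PiM)
    from measurable_compose[OF this measurable_component_singleton, of k] show ?thesis by simp
  qed
  have A: "?A j \<in> sets ?G" for j
  proof -
    have "{\<omega> \<in> space ?G. hits_at r (\<lambda>n. X n \<omega>) j n \<and> X 0 \<omega> = i} \<in> sets ?G"
      by measurable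
    then show ?thesis by simp
  qed
  have B: "?B j \<in> sets ?H" for j
    using in_vimage_algebra[of "{j}" "count_space UNIV" M "space P"]
    by (simp add: vimage_def Int_def conj_commute)
  \<comment> \<open>Independence includes that both generated sigma-algebras consist of events;
    measurability of \<open>M\<close> enters this way.\<close>
  have AB: "?A j \<in> events" "?B j \<in> events" for j
    using A B indep by (auto simp: indep_sets2_eq)
  have prob: "prob (?A j \<inter> ?B j) = \<pi> $ j * prob (?A j)" for j
    using indep_setD[OF indep A B] law by simp
  have "{\<omega> \<in> space P. mixing_time r X M \<omega> = enat n \<and> X 0 \<omega> = i} = (\<Union>j. ?A j \<inter> ?B j)"
    by (auto simp: mixing_time_eq_enat_iff)
  also have "prob \<dots> = (\<Sum>j\<in>UNIV. prob (?A j \<inter> ?B j))"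
    using AB by (intro finite_measure_finite_Union) (auto simp: disjoint_family_on_def)
  finally show ?thesis
    by (simp add: mixing_prob_def cond_prob_def prob sum_divide_distrib)
qed

text \<open>At \<open>n = 0\<close> both sides vanish, the right one because a hit counted from time
  1 cannot occur at time 0.\<close>

lemma first_passage_prob_eq_hits_at:
  "first_passage_prob P X i j n = \<P>(\<omega> in P. hits_at 1 (\<lambda>n. X n \<omega>) j n \<bar> X 0 \<omega> = i)"
proof (cases n)
  case (Suc m)
  then show ?thesis
    by (simp add: first_passage_prob_def hits_at_def atLeastLessThanSuc_atLeastAtMost)
qed (simp add: first_passage_prob_def hits_at_def cond_prob_def)

text \<open>A path starting in \<open>i\<close> avoids \<open>j\<close> at time 0, so including time
  0 in the count changes nothing.\<close>

lemma cond_prob_hits_at_0: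
  assumes "i \<noteq> j"
  shows "\<P>(\<omega> in P. hits_at 0 (\<lambda>n. X n \<omega>) j n \<bar> X 0 \<omega> = i) = first_passage_prob P X i j n"
proof -
  have "hits_at 0 x j n \<longleftrightarrow> hits_at 1 x j n" if "x 0 = i" for x
  proof -
    have "x k \<noteq> j" if "k < 1" for k
      using that assms \<open>x 0 = i\<close> by simp
    then have "(\<forall>k\<in>{0..<n}. x k \<noteq> j) \<longleftrightarrow> (\<forall>k\<in>{1..<n}. x k \<noteq> j)"
      by (meson atLeastLessThan_iff le0 not_le)
    moreover have "x n = j \<Longrightarrow> 1 \<le> n"
      using \<open>\<And>k. k < 1 \<Longrightarrow> x k \<noteq> j\<close> not_le by blast
    ultimately show ?thesis
      by (auto simp: hits_at_def)
  qed
  then show ?thesis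
    unfolding first_passage_prob_eq_hits_at cond_prob_def
    by (intro arg_cong2[where f = "(/)"] arg_cong[where f = "measure P"] refl) auto
qed

text \<open>Positivity makes the value at \<open>n = 0\<close> equal to 1; for a null condition the
  quotient would be 0.\<close>

lemma cond_prob_hits_at_0_self:
  assumes "\<P>(\<omega> in P. X 0 \<omega> = i) > 0"
  shows "\<P>(\<omega> in P. hits_at 0 (\<lambda>n. X n \<omega>) i n \<bar> X 0 \<omega> = i) = (if n = 0 then 1 else 0)"
proof -
  have "hits_at 0 (\<lambda>n. X n \<omega>) i n \<and> X 0 \<omega> = i \<longleftrightarrow> n = 0 \<and> X 0 \<omega> = i" for \<omega>
    by (cases n) (auto simp: hits_at_def)
  then show ?thesis
    using assms unfolding cond_prob_def by simp
qed

lemma mixing_gf_nth: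
  fixes X :: "nat \<Rightarrow> 'w \<Rightarrow> 's::finite" and s :: "'a::{real_normed_field,banach}"
  assumes chain: "markov_chain (P i) X p" and mix: "mixing_variable (P i) X \<pi> M"
    and s: "norm s < 1"
  shows "mixing_gf P X M r s $ i = (\<Sum>j\<in>UNIV.
      gen_fun (\<lambda>n. \<P>(\<omega> in P i. hits_at r (\<lambda>n. X n \<omega>) j n \<bar> X 0 \<omega> = i)) s * of_real (\<pi> $ j))"
proof -
  interpret prob_space "P i"
    using chain by (simp add: markov_chain_def)
  have [measurable]: "X n \<in> measurable (P i) (count_space UNIV)" for n
    using chain by (simp add: markov_chain_def)
  have "mixing_prob (P i) X M r i = (\<lambda>n. \<Sum>j\<in>UNIV.
      \<pi> $ j * \<P>(\<omega> in P i. hits_at r (\<lambda>n. X n \<omega>) j n \<bar> X 0 \<omega> = i))"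
    using mixing_prob_eq_sum[OF chain mix] by blast
  moreover have "\<bar>\<P>(\<omega> in P i. hits_at r (\<lambda>n. X n \<omega>) j n \<bar> X 0 \<omega> = i)\<bar> \<le> 1" for j n
    by (intro abs_cond_prob_le_1) measurable
  ultimately show ?thesis
    using s by (simp add: mixing_gf_def gen_fun_sum[where C = 1] mult.commute)
qed

(* The measures P i are laws of the same chain with possibly different initial distributions,
   P i giving positive probability to X_0 = i. If one law gives positive probability to every
   state, P may be constant; P i may also be the law of the chain started in i. *)
theorem theorem2p3:
  fixes P :: "'s::finite \<Rightarrow> 'w measure"
    and X :: "nat \<Rightarrow> 'w \<Rightarrow> 's"
    and M :: "'w \<Rightarrow> 's"
    and p :: "real^'s^'s"
    and \<pi> :: "real^'s"
    and s :: "'a::{real_normed_field,banach}"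
  assumes chain: "\<And>i. markov_chain (P i) X p"
    and init: "\<And>i. \<P>(\<omega> in P i. X 0 \<omega> = i) > 0"
    and irred: "irreducible_matrix p"
    and stat: "stationary_vector p \<pi>"
    and mix: "\<And>i. mixing_variable (P i) X \<pi> M"
    and s: "norm s < 1"
  shows "mixing_gf P X M 0 s =
           (first_passage_gf P X s + mat 1 - diag_part (first_passage_gf P X s)) *v of_real_vec \<pi>
       \<and> mixing_gf P X M 1 s = first_passage_gf P X s *v of_real_vec \<pi>"
proof -
  let ?F = "first_passage_gf P X s"
  note nth = mixing_gf_nth[OF chain mix s]
  have F: "gen_fun (first_passage_prob (P i) X i j) s = ?F $ i $ j" for i j
    by (simp add: first_passage_gf_def)
  \<comment> \<open>Off the diagonal the matrix entry is that of \<open>?F\<close>. On the diagonal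
    it is replaced by 1, the generating function of the constant time 0.\<close>
  have "gen_fun (\<lambda>n. \<P>(\<omega> in P i. hits_at 0 (\<lambda>n. X n \<omega>) j n \<bar> X 0 \<omega> = i)) s
      = (?F + mat 1 - diag_part ?F) $ i $ j" for i j
    by (cases "i = j")
      (simp_all add: cond_prob_hits_at_0_self[where X = X, OF init] cond_prob_hits_at_0 gen_fun_unit F
        diag_part_def mat_def)
  then have "mixing_gf P X M 0 s = (?F + mat 1 - diag_part ?F) *v of_real_vec \<pi>"
    by (simp add: vec_eq_iff nth matrix_vector_mult_def of_real_vec_def)
  moreover have "mixing_gf P X M 1 s = ?F *v of_real_vec \<pi>"
    \<comment> \<open>Counted from time 1, the coefficients are first passage probabilities on the
      diagonal too, so no correction arises.\<close>
    by (simp only: vec_eq_iff nth flip: first_passage_prob_eq_hits_at)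
      (simp add: F matrix_vector_mult_def of_real_vec_def)
  ultimately show ?thesis by blast
qed

end
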